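(* Consider the stochastic system $x_{k+1}=f(x_k,u_k)+w_k$ with state $x_k\in\mathcal{X}\subseteq\mathbb{R}^n$, input $u_k\in\mathcal{U}\subseteq\mathbb{R}^m$, $f:\mathcal{X}\times\mathcal{U}\to\mathcal{X}$ Borel-measurable, finite time horizon $N\in\mathbb{N}$, and i.i.d. disturbance process $\{w_k\}_{k=0}^{N-1}$, where $w_k$ takes values in $\mathcal{W}\subseteq\mathbb{R}^n$ with law $\mathbb{P}_w$ that is absolutely continuous with continuous density $\psi_w$. Let $\beta\in[0,1]$, let $\mathcal{K},\mathcal{T}\subseteq\mathcal{X}$ be closed sets, and let $\mathcal{U}$ be compact. If, for any $t\in\mathbb{Z}_{[0,N]}$, the set $\mathcal{E}\subseteq\mathcal{W}$ is such that $\mathbb{P}_w(w_k\in\mathcal{E})=\beta^{1/t}$ for all $k\in\mathbb{Z}_{[0,t-1]}$ (a vacuous condition when $t=0$), then $$\mathcal{D}_t(\mathcal{T},\mathcal{K},\mathcal{E})\subseteq\mathcal{L}_t(\beta),$$ where $\mathcal{D}_t(\mathcal{T},\mathcal{K},\mathcal{E})$ is the $t$-time robust reach-avoid set and $\mathcal{L}_t(\beta)$ is the stochastic reach-avoid $\beta$-level-set.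
   Context: All trajectories are understood to lie in the state space $\mathcal{X}$, and $0_n\in\mathcal{W}$. $\mathbb{N}$ includes $0$; $\mathbb{Z}_{[a,b]}=\{a,\dots,b\}$; $\mathbf{1}_{\mathcal{S}}$ is the indicator function of $\mathcal{S}$. Robust reach-avoid set. A state-feedback law is any function $\nu:\mathcal{X}\to\mathcal{U}$ (no measurability required). A control policy of length $t$ is a sequence $\rho_t=[\nu_0,\dots,\nu_{t-1}]$ of such laws, $u_k=\nu_k(x_k)$; $\mathcal{P}_t$ is the set of these. For $\mathcal{E}\subseteq\mathcal{W}$, with $\bar w_t=(w_0,\dots,w_{t-1})$, $$\mathcal{D}_t(\mathcal{T},\mathcal{K},\mathcal{E})=\{x_0\in\mathcal{X}:\exists\rho_t\in\mathcal{P}_t,\ \forall\bar w_t\in\mathcal{E}^t,\ \forall k\in\mathbb{Z}_{[0,t-1]},\ x_k\in\mathcal{K},\ \text{and } x_t\in\mathcal{T}\}.$$ Stochastic reach-avoid level-set. A Markov policy is $\pi=[\mu_0,\dots,\mu_{N-1}]$ with each $\mu_k:\mathcal{X}\to\mathcal{U}$ universally measurable; $\mathcal{M}$ is the set of these. Let $\pi^\ast=[\mu_0^\ast,\dots,\mu_{N-1}^\ast]\in\mathcal{M}$ be an optimal (dynamic-programming) Markov policy for $$\sup_{\pi\in\mathcal{M}}\mathbb{E}^{\pi}\Big[\Big(\prod_{i=0}^{N-1}\mathbf{1}_{\mathcal{K}}(x_i)\Big)\mathbf{1}_{\mathcal{T}}(x_N)\Big];$$ existence of $\pi^\ast$ is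 taken as given. The associated value functions $V_k^\ast:\mathcal{X}\to[0,1]$ are $V_N^\ast(x)=\mathbf{1}_{\mathcal{T}}(x)$ and, for $k\in\mathbb{Z}_{[0,N-1]}$, $$V_k^\ast(x)=\mathbf{1}_{\mathcal{K}}(x)\int_{\mathcal{X}}V_{k+1}^\ast(y)\,\psi_w\big(y-f(x,\mu_k^\ast(x))\big)\,dy,$$ where $\mu_k^\ast(x)$ maximizes over $u\in\mathcal{U}$ the quantity $\mathbf{1}_{\mathcal{K}}(x)\int_{\mathcal{X}}V_{k+1}^\ast(y)\psi_w(y-f(x,u))\,dy$ for every $x\in\mathcal{X}$. Thus $V_k^\ast(x)$ is the maximal probability, starting from $x$ at time $k$, that $x_k,\dots,x_{N-1}\in\mathcal{K}$ and $x_N\in\mathcal{T}$. For $\beta\in[0,1]$ and $k\in\mathbb{Z}_{[0,N]}$, $$\mathcal{L}_k(\beta)=\{x\in\mathcal{X}:V_{N-k}^\ast(x)\ge\beta\}.$$ *)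

theory Defs
  imports "HOL-Probability.Probability"
begin

definition universally_measurable_on ::
  "'a::topological_space set \<Rightarrow> 'b::topological_space set \<Rightarrow> ('a \<Rightarrow> 'b) \<Rightarrow> bool" where
  "universally_measurable_on S R g \<longleftrightarrow> g \<in> S \<rightarrow> R \<and>
     (\<forall>P. prob_space P \<and> sets P = sets (restrict_space borel S) \<longrightarrow>
        g \<in> completion P \<rightarrow>\<^sub>M restrict_space borel R)"

text \<open>A policy is a sequence of feedback laws indexed by time; only the entries below the
  relevant horizon are constrained or used, and each law only matters on the state space.\<close>

primrec trajectory ::
  "('x \<Rightarrow> 'u \<Rightarrow> 'x) \<Rightarrow> (nat \<Rightarrow> 'x \<Rightarrow> 'u) \<Rightarrow> 'x \<Rightarrow> (nat \<Rightarrow> 'x) \<Rightarrow> nat \<Rightarrow> 'x::plus" where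
  "trajectory f \<nu> x0 w 0 = x0"
| "trajectory f \<nu> x0 w (Suc k) =
     f (trajectory f \<nu> x0 w k) (\<nu> k (trajectory f \<nu> x0 w k)) + w k"

definition control_policies :: "'x set \<Rightarrow> 'u set \<Rightarrow> nat \<Rightarrow> (nat \<Rightarrow> 'x \<Rightarrow> 'u) set" where
  "control_policies X U t = {\<nu>. \<forall>k<t. \<nu> k \<in> X \<rightarrow> U}"

definition robust_reach_avoid_set ::
  "'x::plus set \<Rightarrow> 'u set \<Rightarrow> ('x \<Rightarrow> 'u \<Rightarrow> 'x) \<Rightarrow> nat \<Rightarrow> 'x set \<Rightarrow> 'x set \<Rightarrow> 'x set \<Rightarrow> 'x set" where
  "robust_reach_avoid_set X U f t T K E =
     {x0 \<in> X. \<exists>\<nu>\<in>control_policies X U t. \<forall>w. (\<forall>k<t. w k \<in> E) \<longrightarrow>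
        (\<forall>k<t. trajectory f \<nu> x0 w k \<in> K) \<and> trajectory f \<nu> x0 w t \<in> T}"

definition markov_policies ::
  "'x::topological_space set \<Rightarrow> 'u::topological_space set \<Rightarrow> nat \<Rightarrow> (nat \<Rightarrow> 'x \<Rightarrow> 'u) set" where
  "markov_policies X U N = {\<mu>. \<forall>k<N. universally_measurable_on X U (\<mu> k)}"

text \<open>The integrand is a universally measurable function of the disturbances, so in general it
  is measurable only with respect to the completion of \<open>M\<close>.\<close>

definition reach_avoid_probability ::
  "'w measure \<Rightarrow> (nat \<Rightarrow> 'w \<Rightarrow> 'x::plus) \<Rightarrow> ('x \<Rightarrow> 'u \<Rightarrow> 'x) \<Rightarrow> nat \<Rightarrow> 'x set \<Rightarrow> 'x set
     \<Rightarrow> (nat \<Rightarrow> 'x \<Rightarrow> 'u) \<Rightarrow> 'x \<Rightarrow> real" where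
  "reach_avoid_probability M w f N K T \<mu> x0 =
     (\<integral>\<omega>. (\<Prod>i<N. indicator K (trajectory f \<mu> x0 (\<lambda>k. w k \<omega>) i)) *
          indicator T (trajectory f \<mu> x0 (\<lambda>k. w k \<omega>) N) \<partial>completion M)"

text \<open>One-step backup of a value function \<open>V\<close> under the input \<open>u\<close>. Value functions are only
  universally measurable, so the integral is with respect to the completed measure
  \<^const>\<open>lebesgue\<close>.\<close>

definition backup ::
  "'x::euclidean_space set \<Rightarrow> ('x \<Rightarrow> 'u \<Rightarrow> 'x) \<Rightarrow> ('x \<Rightarrow> real) \<Rightarrow> 'x set \<Rightarrow> ('x \<Rightarrow> real)
     \<Rightarrow> 'x \<Rightarrow> 'u \<Rightarrow> real" where
  "backup X f \<psi> K V x u =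
     indicator K x * (LINT y:X|lebesgue. V y * \<psi> (y - f x u))"

text \<open>The value functions \<open>V k\<close>, defined by backward recursion from \<open>k = N\<close>;
  values at \<open>k > N\<close> are irrelevant.\<close>

function value_function ::
  "'x::euclidean_space set \<Rightarrow> ('x \<Rightarrow> 'u \<Rightarrow> 'x) \<Rightarrow> ('x \<Rightarrow> real) \<Rightarrow> nat \<Rightarrow> 'x set \<Rightarrow> 'x set
     \<Rightarrow> (nat \<Rightarrow> 'x \<Rightarrow> 'u) \<Rightarrow> nat \<Rightarrow> 'x \<Rightarrow> real" where
  "value_function X f \<psi> N K T \<mu> k =
     (if N \<le> k then indicator T
      else (\<lambda>x. backup X f \<psi> K (value_function X f \<psi> N K T \<mu> (Suc k)) x (\<mu> k x)))"
  by pat_completeness auto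
termination
  by (relation "Wellfounded.measure (\<lambda>(X, f, \<psi>, N, K, T, \<mu>, k). N - k)") auto

declare value_function.simps [simp del]

definition optimal_markov_policy ::
  "'w measure \<Rightarrow> (nat \<Rightarrow> 'w \<Rightarrow> 'x::euclidean_space) \<Rightarrow> ('x \<Rightarrow> real) \<Rightarrow> 'x set
     \<Rightarrow> 'u::topological_space set \<Rightarrow> ('x \<Rightarrow> 'u \<Rightarrow> 'x) \<Rightarrow> nat \<Rightarrow> 'x set \<Rightarrow> 'x set
     \<Rightarrow> (nat \<Rightarrow> 'x \<Rightarrow> 'u) \<Rightarrow> bool" where
  "optimal_markov_policy M w \<psi> X U f N K T \<mu> \<longleftrightarrow>
     \<mu> \<in> markov_policies X U N \<and>
     (\<forall>\<pi>\<in>markov_policies X U N. \<forall>x0\<in>X.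
        reach_avoid_probability M w f N K T \<pi> x0 \<le> reach_avoid_probability M w f N K T \<mu> x0) \<and>
     (\<forall>k<N. \<forall>x\<in>X. \<forall>u\<in>U.
        backup X f \<psi> K (value_function X f \<psi> N K T \<mu> (Suc k)) x u
          \<le> backup X f \<psi> K (value_function X f \<psi> N K T \<mu> (Suc k)) x (\<mu> k x))"

definition reach_avoid_level_set ::
  "'x::euclidean_space set \<Rightarrow> ('x \<Rightarrow> 'u \<Rightarrow> 'x) \<Rightarrow> ('x \<Rightarrow> real) \<Rightarrow> nat \<Rightarrow> 'x set \<Rightarrow> 'x set
     \<Rightarrow> (nat \<Rightarrow> 'x \<Rightarrow> 'u) \<Rightarrow> nat \<Rightarrow> real \<Rightarrow> 'x set" where
  "reach_avoid_level_set X f \<psi> N K T \<mu> k \<beta> =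
     {x \<in> X. value_function X f \<psi> N K T \<mu> (N - k) x \<ge> \<beta>}"

end

theory Submission
  imports Defs
begin

text \<open>Backward induction along the robust trajectories: at every state reachable with disturbances
  in \<open>E\<close> after \<open>j\<close> steps, the value function at time \<open>N - t + j\<close> is at least \<open>p ^ (t - j)\<close>, where
  \<open>p = \<beta> powr (1 / t)\<close> is the probability of \<open>E\<close>. Indeed, the optimal input does at least as well as
  the robust one, and under the robust input the next state is again reachable with probability
  at least \<open>p\<close>. The robust law may be non-measurable; it enters only through its value at one state.\<close>

section \<open>From universal to Lebesgue measurability\<close>

text \<open>Normalized Lebesgue measure on a piece of \<open>K\<close> of finite positive measure
  can be transported to a probability on \<open>X\<close>. Measurability of \<open>A\<close> for its
  completion then yields Lebesgue measurability on that piece, and countably many pieces exhaust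
  \<open>K\<close>.\<close>

lemma universally_measurable_on_completion_sets:
  fixes X K :: "'a::euclidean_space set"
  assumes A: "\<And>P. prob_space P \<Longrightarrow> sets P = sets (restrict_space borel X) \<Longrightarrow> A \<in> sets (completion P)"
    and "K \<subseteq> X" and K: "K \<in> sets borel"
  shows "A \<inter> K \<in> sets lebesgue"
proof -
  have bounded_part: "A \<inter> C \<in> sets lebesgue"
    if "C \<subseteq> X" and C: "C \<in> sets borel" and fin: "emeasure lborel C \<noteq> \<infinity>" for C
  proof (cases "emeasure lborel C = 0")
    case True
    then have "C \<in> null_sets lborel" using C by auto
    then show ?thesis
      by (metis completion.complete2 null_sets_completionI null_setsD2 inf_le2 null_sets_completion_subset)
  next
    case False
    then obtain x0 where x0: "x0 \<in> C" by fastforce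
    define Q where "Q = uniform_measure lborel C"
    \<comment> \<open>\<open>X\<close> may fail to be Borel, so the uniform measure is carried into
      \<open>X\<close> by a Borel map that is the identity on \<open>C\<close> and sends everything
      else to one point of \<open>C\<close>.\<close>
    define h where "h x = (if x \<in> C then x else x0)" for x
    define P where "P = distr Q (restrict_space borel X) h"
    have Q: "prob_space Q" unfolding Q_def
      by (rule prob_space_uniform_measure) (use False fin in auto)
    have "h \<in> borel \<rightarrow>\<^sub>M borel" unfolding h_def using C by measurable
    then have h: "h \<in> Q \<rightarrow>\<^sub>M restrict_space borel X"
      unfolding Q_def using x0 \<open>C \<subseteq> X\<close>
      by (intro measurable_restrict_space2) (auto simp: h_def cong: measurable_cong_sets)
    have P: "prob_space P" unfolding P_def by (rule prob_space.prob_space_distr[OF Q h])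
    have sP: "sets P = sets (restrict_space borel X)" by (simp add: P_def)
    \<comment> \<open>Members of \<open>sets P\<close> are Borel only relative to \<open>X\<close>;
      cutting down to the Borel set \<open>C\<close> inside \<open>X\<close> makes them Borel in the
      whole space.\<close>
    have borel_trace: "S \<inter> C \<in> sets borel" if "S \<in> sets P" for S
    proof -
      have "S \<in> (\<inter>) X ` sets borel" using that by (simp add: sP sets_restrict_space)
      then obtain B where "B \<in> sets borel" "S = X \<inter> B" by blast
      then have "S \<inter> C = B \<inter> C" using \<open>C \<subseteq> X\<close> by auto
      then show ?thesis using C \<open>B \<in> sets borel\<close> by auto
    qed
    obtain S Z Z' where dec: "A = S \<union> Z" "Z \<subseteq> Z'" "Z' \<in> null_sets P" "S \<in> sets P"
      using A[OF P sP] by (rule sets_completionE) auto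
    have "0 = emeasure Q (h -` Z' \<inter> space Q)"
      using dec(3) h unfolding P_def by (auto simp: null_sets_def emeasure_distr)
    also have "\<dots> = emeasure lborel (C \<inter> (h -` Z' \<inter> space Q)) / emeasure lborel C"
      unfolding Q_def
      by (rule emeasure_uniform_measure)
        (use C measurable_sets[OF h, of Z'] dec(3) sP in \<open>auto simp: Q_def\<close>)
    also have "C \<inter> (h -` Z' \<inter> space Q) = Z' \<inter> C" by (auto simp: h_def Q_def)
    finally have "emeasure lborel (Z' \<inter> C) = 0"
      using fin by (auto simp: ennreal_divide_eq_0_iff)
    then have "Z' \<inter> C \<in> null_sets lborel" using borel_trace[of Z'] dec(3) by (simp add: null_sets_def)
    then have "A \<inter> C \<in> sets (completion lborel)"
      using borel_trace[OF dec(4)] dec(1,2)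
      by (intro sets_completionI[of _ "S \<inter> C" "Z \<inter> C" "Z' \<inter> C"]) auto
    then show ?thesis .
  qed
  have "A \<inter> K = (\<Union>r::nat. A \<inter> (K \<inter> cball 0 (real r)))"
  proof -
    have "\<exists>r::nat. norm x \<le> real r" for x :: 'a using real_arch_simple by blast
    then show ?thesis by auto
  qed
  moreover have "A \<inter> (K \<inter> cball 0 (real r)) \<in> sets lebesgue" for r :: nat
  proof (rule bounded_part)
    have "emeasure lborel (K \<inter> cball 0 (real r)) \<le> emeasure lborel (cball 0 (real r) :: 'a set)"
      using K by (intro emeasure_mono) auto
    then show "emeasure lborel (K \<inter> cball 0 (real r)) \<noteq> \<infinity>"
      using emeasure_lborel_cball_finite[of "0::'a" "real r"] by (auto simp: top_unique)
  qed (use \<open>K \<subseteq> X\<close> K in auto)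
  ultimately show ?thesis by (metis (no_types, lifting) sets.countable_UN image_subsetI)
qed

text \<open>The graph map of \<open>g\<close> is measurable for the completion of every probability
  on \<open>X\<close>, and composing it with the Borel map \<open>f\<close> keeps this. The domain
  is \<open>K\<close> because the preceding lemma needs a Borel subset of \<open>X\<close>.\<close>

lemma universally_measurable_feedback:
  fixes X K :: "'a::euclidean_space set" and U :: "'u::second_countable_topology set"
    and f :: "'a \<Rightarrow> 'u \<Rightarrow> 'b::topological_space"
  assumes f: "(\<lambda>(x, u). f x u) \<in> restrict_space borel (X \<times> U) \<rightarrow>\<^sub>M borel"
    and g: "universally_measurable_on X U g" and "K \<subseteq> X" and K: "K \<in> sets borel"
  shows "(\<lambda>x. f x (g x)) \<in> lebesgue_on K \<rightarrow>\<^sub>M borel"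
proof (rule measurableI)
  fix B :: "'b set" assume B: "B \<in> sets borel"
  let ?A = "(\<lambda>x. f x (g x)) -` B \<inter> X"
  have "?A \<inter> K \<in> sets lebesgue"
  proof (rule universally_measurable_on_completion_sets)
    fix P :: "'a measure" assume P: "prob_space P" "sets P = sets (restrict_space borel X)"
    have sp: "space P = X" using sets_eq_imp_space_eq[OF P(2)] by (simp add: space_restrict_space)
    have gU: "g \<in> X \<rightarrow> U" and "g \<in> completion P \<rightarrow>\<^sub>M restrict_space borel U"
      using g P unfolding universally_measurable_on_def by auto
    then have [measurable]: "g \<in> completion P \<rightarrow>\<^sub>M borel" by (simp add: measurable_restrict_space2_iff)
    have "(\<lambda>x. x) \<in> P \<rightarrow>\<^sub>M borel"
      using measurable_restrict_space1[of "\<lambda>x. x" borel borel X] P(2)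
      by (simp cong: measurable_cong_sets)
    then have [measurable]: "(\<lambda>x. x) \<in> completion P \<rightarrow>\<^sub>M borel" by (rule measurable_completion)
    \<comment> \<open>Second countability of both factors enters here: pairing is measurable for the
      Borel sets of the product topology.\<close>
    have "(\<lambda>x. (x, g x)) \<in> completion P \<rightarrow>\<^sub>M borel" by (rule borel_measurable_Pair) measurable
    then have "(\<lambda>x. (x, g x)) \<in> completion P \<rightarrow>\<^sub>M restrict_space borel (X \<times> U)"
      using gU sp by (intro measurable_restrict_space2) auto
    from measurable_compose[OF this f] have "(\<lambda>x. f x (g x)) \<in> completion P \<rightarrow>\<^sub>M borel" by simp
    from measurable_sets[OF this B] show "?A \<in> sets (completion P)" by (simp add: sp)
  qed (use assms in auto)
  moreover have "?A \<inter> K = (\<lambda>x. f x (g x)) -` B \<inter> space (lebesgue_on K)"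
    using \<open>K \<subseteq> X\<close> by auto
  ultimately show "(\<lambda>x. f x (g x)) -` B \<inter> space (lebesgue_on K) \<in> sets (lebesgue_on K)"
    using K by (simp add: sets_restrict_space_iff)
qed simp

section \<open>Integrals against the translated density\<close>

text \<open>A Borel version \<open>V'\<close> differs from \<open>V\<close> on a null set
  independent of \<open>z\<close>, so the integrals agree for every \<open>z\<close>, and the new
  integrand is jointly Borel. Borel measurability in \<open>z\<close>, not just Lebesgue, permits
  composition with the closed-loop map.\<close>

lemma borel_measurable_translated_integral:
  fixes V \<psi> :: "'a::euclidean_space \<Rightarrow> real"
  assumes V: "V \<in> borel_measurable lebesgue" and [measurable]: "\<psi> \<in> borel_measurable borel"
  shows "(\<lambda>z. LINT y|lebesgue. V y * \<psi> (y - z)) \<in> borel_measurable borel"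
proof -
  obtain V' where [measurable]: "V' \<in> borel_measurable lborel" and ae: "AE x in lborel. V x = V' x"
    using completion_ex_borel_measurable_real[OF V] by auto
  have "(LINT y|lebesgue. V y * \<psi> (y - z)) = (LINT y|lborel. V' y * \<psi> (y - z))" for z
  proof -
    have "(LINT y|lebesgue. V y * \<psi> (y - z)) = (LINT y|lebesgue. V' y * \<psi> (y - z))"
    proof (rule integral_cong_AE)
      have "(\<lambda>y. \<psi> (y - z)) \<in> borel_measurable lebesgue"
        by (intro measurable_completion) measurable
      with V show "(\<lambda>y. V y * \<psi> (y - z)) \<in> borel_measurable lebesgue"
        by (rule borel_measurable_times)
      show "AE y in lebesgue. V y * \<psi> (y - z) = V' y * \<psi> (y - z)"
        using AE_completion[OF ae] by eventually_elim simp
    qed (intro measurable_completion, measurable)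
    also have "\<dots> = (LINT y|lborel. V' y * \<psi> (y - z))" by (rule integral_completion) measurable
    finally show ?thesis .
  qed
  then show ?thesis by simp
qed

text \<open>The substitution \<open>y = z + v\<close> preserves Lebesgue measure, and \<psi> is the
  density of \<open>w\<close>; the backup integral is thus an expectation over the next
  state.\<close>

lemma translated_density_integral:
  fixes \<psi> :: "'a::euclidean_space \<Rightarrow> real"
  assumes [measurable]: "\<psi> \<in> borel_measurable borel" "g \<in> borel_measurable borel"
    and D: "distributed M lborel w (\<lambda>x. ennreal (\<psi> x))" and nn: "\<And>x. 0 \<le> \<psi> x"
  shows "(LINT y|lborel. g y * \<psi> (y - z)) = (LINT \<omega>|M. g (z + w \<omega>) :: real)"
proof -
  have "(LINT y|lborel. g y * \<psi> (y - z)) = (LINT y|distr lborel borel ((+) z). g y * \<psi> (y - z))"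
    by (simp add: lborel_distr_plus)
  also have "\<dots> = (LINT v|lborel. \<psi> v * g (z + v))"
    by (subst integral_distr) (auto simp: mult.commute)
  also have "\<dots> = (LINT \<omega>|M. g (z + w \<omega>))"
    by (rule distributed_integral[OF D]) (auto simp: nn)
  finally show ?thesis .
qed

lemma integrable_translated_density:
  fixes \<psi> :: "'a::euclidean_space \<Rightarrow> real"
  assumes "prob_space M" and [measurable]: "\<psi> \<in> borel_measurable borel"
    and D: "distributed M lborel w (\<lambda>x. ennreal (\<psi> x))" and nn: "\<And>x. 0 \<le> \<psi> x"
  shows "integrable lborel (\<lambda>y. \<psi> (y - z))"
    and "(LINT y|lebesgue. \<psi> (y - z)) = 1"
proof -
  interpret prob_space M by fact
  have one: "(LINT y|lborel. \<psi> (y - z)) = 1"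
    using translated_density_integral[OF assms(2) _ D nn, of "\<lambda>_. 1" z] by (simp add: prob_space)
  \<comment> \<open>A function that is not integrable has Bochner integral \<open>0\<close> by
    convention, so the value \<open>1\<close> forces integrability.\<close>
  then show "integrable lborel (\<lambda>y. \<psi> (y - z))"
    using not_integrable_integral_eq by fastforce
  show "(LINT y|lebesgue. \<psi> (y - z)) = 1" using one by (subst integral_completion) auto
qed

lemma integrable_lebesgue_bounded_times:
  fixes V g :: "'a::euclidean_space \<Rightarrow> real"
  assumes V: "V \<in> borel_measurable lebesgue" and "\<And>x. 0 \<le> V x" "\<And>x. V x \<le> 1"
    and g: "integrable lborel g"
  shows "integrable lebesgue (\<lambda>y. V y * g y)"
proof (rule Bochner_Integration.integrable_bound)
  show g': "integrable lebesgue g" using g by (simp add: integrable_completion)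
  show "(\<lambda>y. V y * g y) \<in> borel_measurable lebesgue"
    using V borel_measurable_integrable[OF g'] by simp
  show "AE y in lebesgue. norm (V y * g y) \<le> norm (g y)"
    using assms(2,3) by (auto simp: abs_mult mult_left_le_one_le)
qed

section \<open>Value functions and one-step bounds\<close>

lemma value_function_terminal: "value_function X f \<psi> N K T \<mu> N = indicator T"
  by (subst value_function.simps) simp

lemma value_function_step:
  assumes "k < N"
  shows "value_function X f \<psi> N K T \<mu> k x =
    backup X f \<psi> K (value_function X f \<psi> N K T \<mu> (Suc k)) x (\<mu> k x)"
  using assms by (subst value_function.simps) simp

lemma value_function_outside:
  assumes "k \<le> N" "K \<subseteq> X" "T \<subseteq> X" "x \<notin> X"
  shows "value_function X f \<psi> N K T \<mu> k x = 0"
proof (cases "k = N")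
  case True
  then show ?thesis using assms by (auto simp: value_function_terminal indicator_def)
next
  case False
  then show ?thesis using assms by (auto simp: value_function_step backup_def indicator_def)
qed

text \<open>Vanishing of \<open>V\<close> off \<open>X\<close> absorbs the indicator of
  \<open>X\<close>, which might not be Lebesgue measurable.\<close>

lemma backup_eq_lebesgue_integral:
  assumes "\<And>y. y \<notin> X \<Longrightarrow> V y = 0"
  shows "backup X f \<psi> K V x u = indicator K x * (LINT y|lebesgue. V y * \<psi> (y - f x u))"
  unfolding backup_def set_lebesgue_integral_def
  using assms by (intro arg_cong[of _ _ "(*) _"] Bochner_Integration.integral_cong)
    (auto simp: indicator_def)

text \<open>Backward induction: the backup is a Borel function of the undisturbed successor,
  composed with the closed-loop map on \<open>K\<close> and extended by zero. The bound
  \<open>1\<close> survives because the density has total mass \<open>1\<close>.\<close>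

lemma value_function_measurable_bounded:
  fixes X K T :: "'x::euclidean_space set" and U :: "'u::second_countable_topology set"
    and \<psi> :: "'x \<Rightarrow> real"
  assumes f: "(\<lambda>(x, u). f x u) \<in> restrict_space borel (X \<times> U) \<rightarrow>\<^sub>M borel"
    and \<mu>: "\<mu> \<in> markov_policies X U N"
    and M: "prob_space M" and \<psi>: "\<psi> \<in> borel_measurable borel" "\<And>x. 0 \<le> \<psi> x"
    and D: "\<And>k. k < N \<Longrightarrow> distributed M lborel (w k) (\<lambda>x. ennreal (\<psi> x))"
    and KT: "K \<subseteq> X" "T \<subseteq> X" "closed K" "closed T"
    and "k \<le> N"
  shows "value_function X f \<psi> N K T \<mu> k \<in> borel_measurable lebesgue \<and>
    (\<forall>x. 0 \<le> value_function X f \<psi> N K T \<mu> k x \<and> value_function X f \<psi> N K T \<mu> k x \<le> 1)"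
  using \<open>k \<le> N\<close>
proof (induction k rule: inc_induct)
  case base
  have "indicator T \<in> borel_measurable (lebesgue :: 'x measure)"
    using KT by (intro borel_measurable_indicator) auto
  then show ?case by (simp add: value_function_terminal)
next
  case (step k)
  define V where "V = value_function X f \<psi> N K T \<mu> (Suc k)"
  define H where "H z = (LINT y|lebesgue. V y * \<psi> (y - z))" for z
  have V: "V \<in> borel_measurable lebesgue" and V01: "0 \<le> V x" "V x \<le> 1" for x
    using step unfolding V_def by auto
  have V0: "V y = 0" if "y \<notin> X" for y
    unfolding V_def using value_function_outside step.hyps KT that by (metis Suc_leI)
  have eq: "value_function X f \<psi> N K T \<mu> k x = indicator K x * H (f x (\<mu> k x))" for x
    using step.hyps by (simp add: value_function_step V_def[symmetric] H_def
        backup_eq_lebesgue_integral[OF V0])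
  have H0: "0 \<le> H z" for z unfolding H_def using V01 \<psi>(2) by (intro integral_nonneg_AE) auto
  have H1: "H z \<le> 1" for z
  proof -
    note dens = integrable_translated_density[OF M \<psi>(1) D[OF step.hyps(2)] \<psi>(2), of z]
    have "H z \<le> (LINT y|lebesgue. \<psi> (y - z))"
      unfolding H_def using V V01 \<psi>(2) dens(1)
      by (intro integral_mono integrable_lebesgue_bounded_times)
        (auto simp: integrable_completion mult_left_le_one_le)
    with dens(2) show ?thesis by simp
  qed
  have H: "H \<in> borel_measurable borel"
    unfolding H_def by (rule borel_measurable_translated_integral[OF V \<psi>(1)])
  have "(\<lambda>x. f x (\<mu> k x)) \<in> lebesgue_on K \<rightarrow>\<^sub>M borel"
    using \<mu> step.hyps KT
    by (intro universally_measurable_feedback[OF f]) (auto simp: markov_policies_def)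
  from measurable_compose[OF this H]
  have "(\<lambda>x. indicator K x *\<^sub>R H (f x (\<mu> k x))) \<in> borel_measurable lebesgue"
    using KT by (subst (asm) borel_measurable_restrict_space_iff) (auto simp: mult.commute)
  then have "value_function X f \<psi> N K T \<mu> k \<in> borel_measurable lebesgue"
    unfolding eq[abs_def] by simp
  moreover have "0 \<le> value_function X f \<psi> N K T \<mu> k x \<and> value_function X f \<psi> N K T \<mu> k x \<le> 1" for x
    using H0 H1 by (simp add: eq indicator_def)
  ultimately show ?case by blast
qed

text \<open>\<open>E\<close> need not be Borel, only its preimage under \<open>w\<close> is measurable; hence the detour through
  a Borel superset of the Lebesgue measurable superlevel set of \<open>V\<close>.\<close>

lemma translated_integral_ge:
  fixes V \<psi> :: "'a::euclidean_space \<Rightarrow> real"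
  assumes M: "prob_space M" and \<psi>: "\<psi> \<in> borel_measurable borel" "\<And>x. 0 \<le> \<psi> x"
    and D: "distributed M lborel w (\<lambda>x. ennreal (\<psi> x))"
    and V: "V \<in> borel_measurable lebesgue" and V01: "\<And>x. 0 \<le> V x" "\<And>x. V x \<le> 1"
    and "0 \<le> c" and VE: "\<And>v. v \<in> E \<Longrightarrow> c \<le> V (z + v)"
    and E: "{\<omega> \<in> space M. w \<omega> \<in> E} \<in> sets M"
  shows "c * measure M {\<omega> \<in> space M. w \<omega> \<in> E} \<le> (LINT y|lebesgue. V y * \<psi> (y - z))"
proof -
  interpret prob_space M by fact
  note [measurable] = \<psi>(1)
  define A where "A = {y. c \<le> V y}"
  have A: "A \<in> sets lebesgue"
    using borel_measurable_le[OF borel_measurable_const V, of c] by (simp add: A_def)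
  then obtain S Z Z' where dec: "A = S \<union> Z" "Z \<subseteq> Z'" "Z' \<in> null_sets lborel" "S \<in> sets lborel"
    by (rule sets_completionE) auto
  define B where "B = S \<union> Z'"
  have B[measurable]: "B \<in> sets borel" using dec by (auto simp: B_def null_sets_def)
  have "A \<subseteq> B" using dec by (auto simp: B_def)
  have ae: "AE y in lebesgue. (indicator B y :: real) = indicator A y"
  proof (rule AE_completion)
    show "AE y in lborel. (indicator B y :: real) = indicator A y"
      using AE_not_in[OF dec(3)] by eventually_elim (use dec in \<open>auto simp: B_def indicator_def\<close>)
  qed
  note dens = integrable_translated_density(1)[OF M \<psi>(1) D \<psi>(2), of z]
  have [measurable]: "w \<in> M \<rightarrow>\<^sub>M borel" using distributed_measurable[OF D] by simp
  have wB: "{\<omega> \<in> space M. z + w \<omega> \<in> B} \<in> sets M" by measurable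
  have "measure M {\<omega> \<in> space M. w \<omega> \<in> E} \<le> measure M {\<omega> \<in> space M. z + w \<omega> \<in> B}"
    using VE \<open>A \<subseteq> B\<close> wB by (intro finite_measure_mono) (auto simp: A_def)
  \<comment> \<open>On \<open>w \<omega> \<in> E\<close> the point \<open>z + w \<omega>\<close>
    lies in \<open>A\<close>, hence in the Borel set \<open>B\<close>, whose probability can be
    computed from the density.\<close>
  also have "\<dots> = (LINT \<omega>|M. indicator {\<omega> \<in> space M. z + w \<omega> \<in> B} \<omega>)" using wB by simp
  also have "\<dots> = (LINT \<omega>|M. indicator B (z + w \<omega>))"
    by (rule Bochner_Integration.integral_cong) (auto simp: indicator_def)
  also have "\<dots> = (LINT y|lborel. indicator B y * \<psi> (y - z))"
    by (rule translated_density_integral[OF \<psi>(1) _ D \<psi>(2), symmetric]) measurable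
  also have "\<dots> = (LINT y|lebesgue. indicator B y * \<psi> (y - z))"
    by (intro integral_completion[symmetric]) measurable
  \<comment> \<open>Back from \<open>B\<close> to \<open>A\<close>: the pointwise bound
    \<open>c \<le> V y\<close> is available only on \<open>A\<close>.\<close>
  also have "\<dots> = (LINT y|lebesgue. indicator A y * \<psi> (y - z))"
  proof (rule integral_cong_AE)
    have m: "(\<lambda>y. \<psi> (y - z)) \<in> borel_measurable lebesgue"
      by (intro measurable_completion) measurable
    show "(\<lambda>y. indicator B y * \<psi> (y - z)) \<in> borel_measurable lebesgue"
      "(\<lambda>y. indicator A y * \<psi> (y - z)) \<in> borel_measurable lebesgue"
      using m A B by (auto intro!: borel_measurable_times borel_measurable_indicator)
    show "AE y in lebesgue. indicator B y * \<psi> (y - z) = indicator A y * \<psi> (y - z)"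
      using ae by eventually_elim simp
  qed
  finally have "c * measure M {\<omega> \<in> space M. w \<omega> \<in> E} \<le>
      (LINT y|lebesgue. c * (indicator A y * \<psi> (y - z)))"
    using \<open>0 \<le> c\<close> by (simp add: mult_left_mono)
  also have "\<dots> \<le> (LINT y|lebesgue. V y * \<psi> (y - z))"
  proof (rule integral_mono)
    show "integrable lebesgue (\<lambda>y. c * (indicator A y * \<psi> (y - z)))"
      using A dens
      by (intro Bochner_Integration.integrable_mult_right integrable_lebesgue_bounded_times)
        (auto simp: indicator_def[abs_def] intro!: borel_measurable_indicator[unfolded indicator_def[abs_def]])
    show "integrable lebesgue (\<lambda>y. V y * \<psi> (y - z))"
      using V V01 dens by (rule integrable_lebesgue_bounded_times)
    show "c * (indicator A y * \<psi> (y - z)) \<le> V y * \<psi> (y - z)" for y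
      using V01 \<psi>(2) by (auto simp: indicator_def A_def mult_right_mono)
  qed
  finally show ?thesis .
qed

section \<open>Robust trajectories and the set inclusion\<close>

text \<open>Causality; it lets the disturbance at time \<open>j\<close> be changed without moving
  the state at time \<open>j\<close>.\<close>

lemma trajectory_cong:
  assumes "\<And>k. k < j \<Longrightarrow> v k = v' k"
  shows "trajectory f \<nu> x0 v j = trajectory f \<nu> x0 v' j"
  using assms by (induction j) auto

theorem theorem4:
  fixes M :: "'w measure"
    and w :: "nat \<Rightarrow> 'w \<Rightarrow> real ^ 'n"
    and \<psi> :: "real ^ 'n \<Rightarrow> real"
    and X W K T E :: "(real ^ 'n) set"
    and U :: "(real ^ 'm) set"
    and f :: "real ^ 'n \<Rightarrow> real ^ 'm \<Rightarrow> real ^ 'n"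
    and \<mu> :: "nat \<Rightarrow> real ^ 'n \<Rightarrow> real ^ 'm"
    and N t :: nat
    and \<beta> :: real
  assumes "(\<lambda>(x, u). f x u) \<in> restrict_space borel (X \<times> U) \<rightarrow>\<^sub>M restrict_space borel X"
    and "0 \<in> W"
    and "\<And>x u v. x \<in> X \<Longrightarrow> u \<in> U \<Longrightarrow> v \<in> W \<Longrightarrow> f x u + v \<in> X"
    and "prob_space M"
    and "\<And>k \<omega>. k < N \<Longrightarrow> \<omega> \<in> space M \<Longrightarrow> w k \<omega> \<in> W"
    and "prob_space.indep_vars M (\<lambda>_. borel) w {..<N}"
    and "\<And>k. k < N \<Longrightarrow> distributed M lborel (w k) (\<lambda>x. ennreal (\<psi> x))"
    and "continuous_on UNIV \<psi>" and "\<And>x. 0 \<le> \<psi> x"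
    and "K \<subseteq> X" and "closed K" and "T \<subseteq> X" and "closed T"
    and "compact U"
    and "optimal_markov_policy M w \<psi> X U f N K T \<mu>"
    and "0 \<le> \<beta>" and "\<beta> \<le> 1"
    and "t \<le> N"
    and "E \<subseteq> W"
    and "\<And>k. k < t \<Longrightarrow> {\<omega> \<in> space M. w k \<omega> \<in> E} \<in> sets M"
    and "\<And>k. k < t \<Longrightarrow> measure M {\<omega> \<in> space M. w k \<omega> \<in> E} = \<beta> powr (1 / real t)"
  shows "robust_reach_avoid_set X U f t T K E \<subseteq> reach_avoid_level_set X f \<psi> N K T \<mu> t \<beta>"
proof
  let ?V = "value_function X f \<psi> N K T \<mu>"
  have opt: "\<mu> \<in> markov_policies X U N"
    "\<And>k x u. k < N \<Longrightarrow> x \<in> X \<Longrightarrow> u \<in> U \<Longrightarrow>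
       backup X f \<psi> K (?V (Suc k)) x u \<le> ?V k x"
    using assms(15) unfolding optimal_markov_policy_def by (auto simp: value_function_step)
  have f: "(\<lambda>(x, u). f x u) \<in> restrict_space borel (X \<times> U) \<rightarrow>\<^sub>M borel"
    using assms(1) by (simp add: measurable_restrict_space2_iff)
  have \<psi>: "\<psi> \<in> borel_measurable borel"
    using assms(8) by (rule borel_measurable_continuous_onI)
  have V: "?V k \<in> borel_measurable lebesgue" "0 \<le> ?V k x" "?V k x \<le> 1" if "k \<le> N" for k x
    using value_function_measurable_bounded[OF f opt(1) assms(4) \<psi> assms(9,7,10,12,11,13) that] by auto
  fix x0 assume "x0 \<in> robust_reach_avoid_set X U f t T K E"
  then obtain \<nu> where "x0 \<in> X" and \<nu>: "\<And>k x. k < t \<Longrightarrow> x \<in> X \<Longrightarrow> \<nu> k x \<in> U"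
    and safe: "\<And>v k. (\<forall>k<t. v k \<in> E) \<Longrightarrow> k < t \<Longrightarrow> trajectory f \<nu> x0 v k \<in> K"
    and reach: "\<And>v. (\<forall>k<t. v k \<in> E) \<Longrightarrow> trajectory f \<nu> x0 v t \<in> T"
    unfolding robust_reach_avoid_set_def control_policies_def by blast
  have "\<beta> \<le> ?V (N - t) x0"
  \<comment> \<open>For \<beta> zero and \<open>t\<close> positive, \<open>E\<close> may be empty
    and the robust condition vacuous; nonnegativity of the value function settles this case.\<close>
  proof (cases "\<beta> = 0")
    case True
    then show ?thesis using V(2) by simp
  next
    case False
    \<comment> \<open>For \<open>t = 0\<close> the convention \<open>1 / 0 = 0\<close> gives
      \<open>p = 1\<close>.\<close>
    define p where "p = \<beta> powr (1 / real t)"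
    have "0 < p" using False by (simp add: p_def)
    \<comment> \<open>The robust problem is aligned with the last \<open>t\<close> stages of the
      horizon. The sequence \<open>v\<close> stays arbitrary in the induction because the step
      replaces its entry at \<open>j\<close>.\<close>
    have bound: "p ^ (t - j) \<le> ?V (N - t + j) (trajectory f \<nu> x0 v j)"
      if "j \<le> t" "\<forall>k<t. v k \<in> E" for j v
      using that
    proof (induction j arbitrary: v rule: inc_induct)
      case base
      then show ?case using reach \<open>t \<le> N\<close> by (simp add: value_function_terminal)
    next
      case (step j)
      let ?x = "trajectory f \<nu> x0 v j"
      let ?z = "f ?x (\<nu> j ?x)"
      have k: "N - t + j < N" using step.hyps \<open>t \<le> N\<close> by simp
      have "?x \<in> K" using safe step by auto
      then have "?x \<in> X" using assms(10) by auto
      \<comment> \<open>Each possible next state lies on the trajectory of the altered sequence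
        \<open>v(j := e)\<close>, still admissible, so the induction hypothesis applies to
        it.\<close>
      have next_ge: "p ^ (t - Suc j) \<le> ?V (Suc (N - t + j)) (?z + e)" if "e \<in> E" for e
      proof -
        have "trajectory f \<nu> x0 (v(j := e)) j = ?x" by (rule trajectory_cong) simp
        then have "trajectory f \<nu> x0 (v(j := e)) (Suc j) = ?z + e"
          by (simp del: fun_upd_apply add: fun_upd_same)
        moreover have "\<forall>k<t. (v(j := e)) k \<in> E" using step.prems that by simp
        ultimately show ?thesis using step.IH[of "v(j := e)"] by (metis add_Suc_right)
      qed
      have "t - j = Suc (t - Suc j)" using step.hyps by simp
      then have "p ^ (t - j) = p ^ (t - Suc j) * measure M {\<omega> \<in> space M. w j \<omega> \<in> E}"
        using assms(21) step.hyps by (simp add: p_def)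
      \<comment> \<open>The value function is taken at a time shifted by \<open>N - t\<close>, while
        the probability of \<open>E\<close> concerns \<open>w j\<close>; this is consistent since
        all disturbances share the density \<psi>.\<close>
      also have "\<dots> \<le> (LINT y|lebesgue. ?V (Suc (N - t + j)) y * \<psi> (y - ?z))"
        using step.hyps \<open>t \<le> N\<close> \<open>0 < p\<close> k next_ge V[of "Suc (N - t + j)"] assms(20)
        by (intro translated_integral_ge[OF assms(4) \<psi> assms(9) assms(7)]) auto
      also have "\<dots> = backup X f \<psi> K (?V (Suc (N - t + j))) ?x (\<nu> j ?x)"
        using \<open>?x \<in> K\<close> k value_function_outside[of "Suc (N - t + j)" N K X T] assms(10,12)
        by (subst backup_eq_lebesgue_integral) auto
      also have "\<dots> \<le> ?V (N - t + j) ?x"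
        using opt(2) k \<open>?x \<in> X\<close> \<nu> step.hyps by auto
      finally show ?case .
    qed
    show ?thesis
    proof (cases "t = 0")
      case True
      \<comment> \<open>No disturbance is constrained, so any sequence will do, and the bound reads
        \<open>1 \<le> ?V N x0\<close>.\<close>
      then show ?thesis using bound[of 0 undefined] \<open>\<beta> \<le> 1\<close> by simp
    next
      case t: False
      \<comment> \<open>Positive probability makes \<open>E\<close> nonempty, so a constant sequence
        in \<open>E\<close> is admissible and the bound can be used at \<open>j = 0\<close>.\<close>
      then have "measure M {\<omega> \<in> space M. w 0 \<omega> \<in> E} > 0"
        using assms(21)[of 0] \<open>0 < p\<close> by (simp add: p_def)
      then obtain e where "e \<in> E" by force
      moreover have "p ^ t = \<beta>"
        using t False \<open>0 \<le> \<beta>\<close> by (simp add: p_def powr_powr flip: powr_realpow' powr_realpow)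
      ultimately show ?thesis using bound[of 0 "\<lambda>_. e"] by simp
    qed
  qed
  with \<open>x0 \<in> X\<close> show "x0 \<in> reach_avoid_level_set X f \<psi> N K T \<mu> t \<beta>"
    by (simp add: reach_avoid_level_set_def)
qed

end
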